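(* Let $A\in\mathbb{R}^{m\times n}$, $b\in\mathbb{R}^m$ and $\lambda>0$. Suppose $x^*$ is the unique minimizer of $$\min_{x\in\mathbb{R}^n}\ \tfrac12\|Ax-b\|_2^2+\lambda\|x\|_1,$$ let $I=\operatorname{supp}(x^* )$, and suppose $A_I$ is a square matrix with full rank. Then all of the following hold: (a) $A_I^T(b-A_Ix_I^* )=\lambda\cdot\operatorname{sign}(x_I^* )$; (b) $\|A_{I^c}^T(b-A_Ix_I^* )\|_\infty<\lambda$; (c) $A_I$ has full column rank.
   Context: For an index set $I\subseteq\{1,\dots,n\}$, $I^c$ is its complement in $\{1,\dots,n\}$, $A_I$ is the submatrix of $A$ formed by the columns $a_i$, $i\in I$, and $x_I$ is the subvector of $x$ formed by the entries $x_i$, $i\in I$. $\operatorname{supp}(x)=\{i:x_i\ne 0\}$, and $\operatorname{sign}$ is applied entrywise. If $I^c=\emptyset$, (b) is vacuous. *)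

theory Defs
  imports
    Complex_Main
    "Jordan_Normal_Form.Matrix"
    "Jordan_Normal_Form.DL_Rank"
    "Jordan_Normal_Form.DL_Submatrix"
begin

text \<open>Matrices and vectors carry their dimensions as natural numbers and are indexed from 0, so the
  index set \<open>{1,...,n}\<close> is rendered as \<open>{..<n}\<close>.\<close>

definition supp :: "real vec \<Rightarrow> nat set" where
  "supp x = {i. i < dim_vec x \<and> x $ i \<noteq> 0}"

abbreviation cols_submatrix :: "real mat \<Rightarrow> nat set \<Rightarrow> real mat" where
  "cols_submatrix A I \<equiv> submatrix A UNIV I"

text \<open>Since \<open>pick I i\<close> is the \<open>i\<close>-th smallest element of \<open>I\<close>, the entries are enumerated in
  the same order as the columns in \<^const>\<open>submatrix\<close>.\<close>

definition subvector :: "real vec \<Rightarrow> nat set \<Rightarrow> real vec" where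
  "subvector x I = vec (card {i. i < dim_vec x \<and> i \<in> I}) (\<lambda>i. x $ pick I i)"

definition l1_norm :: "real vec \<Rightarrow> real" where
  "l1_norm x = (\<Sum>i<dim_vec x. \<bar>x $ i\<bar>)"

definition l2_norm :: "real vec \<Rightarrow> real" where
  "l2_norm x = sqrt (\<Sum>i<dim_vec x. (x $ i)\<^sup>2)"

text \<open>Inserting 0 only matters for the vector of dimension 0, whose norm is thereby 0.\<close>

definition linf_norm :: "real vec \<Rightarrow> real" where
  "linf_norm x = Max (insert 0 ((\<lambda>i. \<bar>x $ i\<bar>) ` {..<dim_vec x}))"

abbreviation mat_rank :: "real mat \<Rightarrow> nat" where
  "mat_rank M \<equiv> vec_space.rank (dim_row M) M"

definition full_rank :: "real mat \<Rightarrow> bool" where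
  "full_rank M \<longleftrightarrow> mat_rank M = min (dim_row M) (dim_col M)"

definition full_column_rank :: "real mat \<Rightarrow> bool" where
  "full_column_rank M \<longleftrightarrow> mat_rank M = dim_col M"

definition lasso_objective :: "real mat \<Rightarrow> real vec \<Rightarrow> real \<Rightarrow> real vec \<Rightarrow> real" where
  "lasso_objective A b l x = 1 / 2 * (l2_norm (A *\<^sub>v x - b))\<^sup>2 + l * l1_norm x"

definition unique_minimizer_on :: "('a \<Rightarrow> real) \<Rightarrow> 'a set \<Rightarrow> 'a \<Rightarrow> bool" where
  "unique_minimizer_on f S x \<longleftrightarrow>
     is_arg_min f (\<lambda>y. y \<in> S) x \<and> (\<forall>y. is_arg_min f (\<lambda>y. y \<in> S) y \<longrightarrow> y = x)"

end

theory Submission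
  imports Defs
begin

text \<open>
  At a minimizer every one-sided directional derivative of the objective is nonnegative; the
  directions \<open>\<plusminus>e\<^sub>j\<close> with \<open>j \<in> I\<close> give (a). If moreover the minimizer is unique, then a
  direction \<open>d \<noteq> 0\<close> with \<open>A d = 0\<close> has a positive derivative, since the objective is affine along a
  short segment in that direction. As \<open>A\<^sub>I\<close> is invertible, each column \<open>a\<^sub>j\<close> with \<open>j \<notin> I\<close> equals
  \<open>A y\<close> for some \<open>y\<close> supported on \<open>I\<close>; by (a) the derivatives in the directions
  \<open>\<plusminus>(e\<^sub>j - y)\<close> are \<open>\<lambda> \<mp> a\<^sub>j\<^sup>T (b - A x)\<close>, and their positivity is (b).
\<close>

section \<open>One-sided derivatives of the objective\<close>

text \<open>The right derivative at \<open>t = 0\<close> of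
  \<open>\<bar>u + t * v\<bar>\<close>.\<close>

definition abs_slope :: "real \<Rightarrow> real \<Rightarrow> real" where
  "abs_slope u v = (if u = 0 then \<bar>v\<bar> else v * sgn u)"

text \<open>The absolute value is linear on each side of 0, so the first-order expansion is exact
  once \<open>t\<close> is too small for \<open>u + t * v\<close> to change sign. This exactness
  later makes the objective affine along kernel directions of \<open>A\<close>.\<close>

lemma eventually_abs_add:
  "eventually (\<lambda>t. \<bar>u + t * v\<bar> = \<bar>u\<bar> + t * abs_slope u v) (at_right 0)"
proof (cases "u = 0")
  case True
  then show ?thesis
    by (auto simp: abs_slope_def abs_mult eventually_at_right_field intro!: exI[of _ 1])
next
  case False
  \<comment> \<open>Positivity of the product with \<open>sgn u\<close> says that the sign of
    \<open>u\<close> is kept; it holds at \<open>t = 0\<close> and persists by continuity.\<close>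
  have "((\<lambda>t. (u + t * v) * sgn u) \<longlongrightarrow> (u + 0 * v) * sgn u) (at_right 0)"
    by (intro tendsto_intros)
  moreover have "(u + 0 * v) * sgn u > 0"
    using False by (simp add: sgn_if)
  ultimately have "eventually (\<lambda>t. (u + t * v) * sgn u > 0) (at_right 0)"
    by (rule order_tendstoD(1))
  then show ?thesis
    by (rule eventually_mono) (use False in \<open>auto simp: abs_slope_def sgn_if abs_if split: if_splits\<close>)
qed

lemma eventually_l1_norm_add:
  assumes "x \<in> carrier_vec n" "d \<in> carrier_vec n"
  shows "eventually (\<lambda>t. l1_norm (x + t \<cdot>\<^sub>v d)
           = l1_norm x + t * (\<Sum>i<n. abs_slope (x $ i) (d $ i))) (at_right 0)"
proof -
  have "eventually (\<lambda>t. \<forall>i\<in>{..<n}. \<bar>x $ i + t * d $ i\<bar> = \<bar>x $ i\<bar> + t * abs_slope (x $ i) (d $ i))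
          (at_right 0)"
    by (intro eventually_ball_finite) (auto intro: eventually_abs_add)
  then show ?thesis
    by (rule eventually_mono) (use assms in \<open>simp add: l1_norm_def sum.distrib sum_distrib_left\<close>)
qed

lemma l2_norm_squared: "(l2_norm v)\<^sup>2 = v \<bullet> v"
  by (simp add: l2_norm_def scalar_prod_def sum_nonneg power2_eq_square lessThan_atLeast0)

text \<open>The linear term is moved to the transpose to exhibit the vector that (a) and (b) speak
  about, the negative gradient of the quadratic part of the objective.\<close>

lemma l2_norm_squared_residual:
  fixes A :: "real mat"
  assumes "A \<in> carrier_mat m n" "b \<in> carrier_vec m" "x \<in> carrier_vec n" "d \<in> carrier_vec n"
  shows "(l2_norm (A *\<^sub>v (x + t \<cdot>\<^sub>v d) - b))\<^sup>2
           = (l2_norm (A *\<^sub>v x - b))\<^sup>2 - 2 * t * (d \<bullet> (A\<^sup>T *\<^sub>v (b - A *\<^sub>v x)))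
             + t\<^sup>2 * ((A *\<^sub>v d) \<bullet> (A *\<^sub>v d))"
proof -
  define r where "r = b - A *\<^sub>v x"
  define w where "w = A *\<^sub>v d"
  have carrier: "r \<in> carrier_vec m" "w \<in> carrier_vec m"
    using assms by (auto simp: r_def w_def)
  have "A *\<^sub>v (x + t \<cdot>\<^sub>v d) - b = t \<cdot>\<^sub>v w - r"
  proof -
    have "A *\<^sub>v (x + t \<cdot>\<^sub>v d) = A *\<^sub>v x + t \<cdot>\<^sub>v w"
      using assms by (simp add: mult_add_distrib_mat_vec[OF assms(1)] mult_mat_vec[OF assms(1)] w_def)
    then show ?thesis
      using assms carrier by (auto simp: r_def)
  qed
  moreover have "A *\<^sub>v x - b = - r"
    using assms by (auto simp: r_def)
  moreover have "d \<bullet> (A\<^sup>T *\<^sub>v r) = w \<bullet> r"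
  proof -
    have "d \<bullet> (A\<^sup>T *\<^sub>v r) = (A\<^sup>T *\<^sub>v r) \<bullet> d"
      using assms carrier by (intro comm_scalar_prod[of _ n]) auto
    also have "\<dots> = r \<bullet> w"
      unfolding w_def using assms carrier by (intro transpose_vec_mult_scalar) auto
    also have "\<dots> = w \<bullet> r"
      using carrier by (rule comm_scalar_prod)
    finally show ?thesis .
  qed
  moreover have "(t \<cdot>\<^sub>v w - r) \<bullet> (t \<cdot>\<^sub>v w - r) = r \<bullet> r - 2 * t * (w \<bullet> r) + t\<^sup>2 * (w \<bullet> w)"
    using carrier
    by (simp add: scalar_prod_def sum_distrib_left algebra_simps power2_eq_square
        flip: sum.distrib sum_subtractf)
  moreover have "(- r) \<bullet> (- r) = r \<bullet> r"
    by simp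
  ultimately show ?thesis
    by (simp add: l2_norm_squared flip: r_def w_def)
qed

text \<open>The directional derivative of the objective at \<open>x\<close> along \<open>d\<close>,
  written coordinatewise so that for well-chosen \<open>d\<close> it collapses to one term.\<close>

definition lasso_slope :: "real mat \<Rightarrow> real vec \<Rightarrow> real \<Rightarrow> real vec \<Rightarrow> real vec \<Rightarrow> real" where
  "lasso_slope A b l x d =
     (\<Sum>i<dim_vec d. l * abs_slope (x $ i) (d $ i) - d $ i * (A\<^sup>T *\<^sub>v (b - A *\<^sub>v x)) $ i)"

lemma eventually_lasso_objective_add:
  assumes "A \<in> carrier_mat m n" "b \<in> carrier_vec m" "x \<in> carrier_vec n" "d \<in> carrier_vec n"
  shows "eventually (\<lambda>t. lasso_objective A b l (x + t \<cdot>\<^sub>v d)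
           = lasso_objective A b l x
             + t * (lasso_slope A b l x d + t / 2 * ((A *\<^sub>v d) \<bullet> (A *\<^sub>v d)))) (at_right 0)"
proof -
  have slope: "lasso_slope A b l x d
          = l * (\<Sum>i<n. abs_slope (x $ i) (d $ i)) - d \<bullet> (A\<^sup>T *\<^sub>v (b - A *\<^sub>v x))"
    using assms
    by (simp add: lasso_slope_def scalar_prod_def[of d] sum_subtractf sum_distrib_left lessThan_atLeast0)
  \<comment> \<open>\<open>N\<close> stands for the squared residual norm, \<open>L\<close> and
    \<open>S\<close> for the l1 norm and its slope, \<open>g\<close> and \<open>q\<close> for the
    linear and quadratic coefficients.\<close>
  have expand: "1 / 2 * (N - 2 * t * g + t\<^sup>2 * q) + l * (L + t * S)
      = 1 / 2 * N + l * L + t * (l * S - g + t / 2 * q)" for N L S g q t :: real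
    by (simp add: algebra_simps power2_eq_square)
  show ?thesis
    using eventually_l1_norm_add[OF assms(3,4)]
  proof eventually_elim
    fix t :: real
    assume l1: "l1_norm (x + t \<cdot>\<^sub>v d) = l1_norm x + t * (\<Sum>i<n. abs_slope (x $ i) (d $ i))"
    show "lasso_objective A b l (x + t \<cdot>\<^sub>v d) = lasso_objective A b l x
        + t * (lasso_slope A b l x d + t / 2 * ((A *\<^sub>v d) \<bullet> (A *\<^sub>v d)))"
      unfolding lasso_objective_def slope l1 l2_norm_squared_residual[OF assms] by (rule expand)
  qed
qed

text \<open>Minimality makes the difference quotient nonnegative for small \<open>t > 0\<close>, and
  its quadratic contribution vanishes in the limit.\<close>

lemma lasso_slope_nonneg:
  assumes "A \<in> carrier_mat m n" "b \<in> carrier_vec m" "d \<in> carrier_vec n"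
    and min: "is_arg_min (lasso_objective A b l) (\<lambda>y. y \<in> carrier_vec n) x"
  shows "lasso_slope A b l x d \<ge> 0"
proof -
  have x: "x \<in> carrier_vec n"
    using min by (simp add: is_arg_min_def)
  let ?f = "\<lambda>t. lasso_slope A b l x d + t / 2 * ((A *\<^sub>v d) \<bullet> (A *\<^sub>v d))"
  have lim: "(?f \<longlongrightarrow> lasso_slope A b l x d + 0 / 2 * ((A *\<^sub>v d) \<bullet> (A *\<^sub>v d))) (at_right 0)"
    by (intro tendsto_intros) auto
  have "eventually (\<lambda>t. ?f t \<ge> 0) (at_right 0)"
    using eventually_lasso_objective_add[OF assms(1,2) x assms(3)]
      eventually_at_right_less[of "0::real"]
  proof eventually_elim
    fix t :: real
    assume eq: "lasso_objective A b l (x + t \<cdot>\<^sub>v d) = lasso_objective A b l x + t * ?f t"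
      and t: "t > 0"
    have "x + t \<cdot>\<^sub>v d \<in> carrier_vec n"
      using x assms(3) by simp
    then have "lasso_objective A b l x \<le> lasso_objective A b l (x + t \<cdot>\<^sub>v d)"
      using min by (auto simp: is_arg_min_linorder)
    then have "0 \<le> t * ?f t"
      using eq by linarith
    then show "?f t \<ge> 0"
      using t by (simp add: zero_le_mult_iff)
  qed
  then show ?thesis
    using tendsto_lowerbound[OF lim] by simp
qed

lemma lasso_slope_pos:
  assumes "A \<in> carrier_mat m n" "b \<in> carrier_vec m" "d \<in> carrier_vec n"
    and min: "unique_minimizer_on (lasso_objective A b l) (carrier_vec n) x"
    and "A *\<^sub>v d = 0\<^sub>v m" and "d \<noteq> 0\<^sub>v n"
  shows "lasso_slope A b l x d > 0"
proof -
  have x: "x \<in> carrier_vec n"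
    and le: "y \<in> carrier_vec n \<Longrightarrow> lasso_objective A b l x \<le> lasso_objective A b l y"
    and unique: "is_arg_min (lasso_objective A b l) (\<lambda>y. y \<in> carrier_vec n) y \<Longrightarrow> y = x" for y
    using min by (auto simp: unique_minimizer_on_def is_arg_min_linorder)
  have "eventually (\<lambda>t. lasso_objective A b l (x + t \<cdot>\<^sub>v d)
      = lasso_objective A b l x + t * lasso_slope A b l x d \<and> t > 0) (at_right 0)"
    using eventually_lasso_objective_add[OF assms(1,2) x assms(3)]
      eventually_at_right_less[of "0::real"]
    by eventually_elim (simp add: assms(5))
  then obtain t where t: "t > 0"
    and eq: "lasso_objective A b l (x + t \<cdot>\<^sub>v d) = lasso_objective A b l x + t * lasso_slope A b l x d"
    using eventually_happens'[of "at_right (0::real)"] by force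
  have y: "x + t \<cdot>\<^sub>v d \<in> carrier_vec n"
    using x assms(3) by simp
  obtain i where "i < n" "d $ i \<noteq> 0"
    using assms(3,6) by (metis carrier_vecD eq_vecI index_zero_vec)
  then have "(x + t \<cdot>\<^sub>v d) $ i \<noteq> x $ i"
    using t assms(3) x by simp
  then have "x + t \<cdot>\<^sub>v d \<noteq> x"
    by metis
  \<comment> \<open>Otherwise this second point would be a minimizer too, against
    uniqueness.\<close>
  then have "\<not> lasso_objective A b l (x + t \<cdot>\<^sub>v d) \<le> lasso_objective A b l x"
    using unique[of "x + t \<cdot>\<^sub>v d"] y le by (force simp: is_arg_min_linorder)
  then show ?thesis
    using t eq by (simp add: not_le zero_less_mult_iff)
qed

section \<open>Column submatrices and subvectors\<close>

text \<open>Turns sums over column positions of a submatrix into sums over the index set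
  itself.\<close>

lemma bij_betw_pick:
  assumes "finite I"
  shows "bij_betw (pick I) {..<card I} I"
proof (rule bij_betw_imageI)
  show inj: "inj_on (pick I) {..<card I}"
    by (rule strict_mono_on_imp_inj_on) (auto simp: strict_mono_on_def intro: pick_mono_le)
  show "pick I ` {..<card I} = I"
    using assms by (intro card_subset_eq) (auto simp: card_image[OF inj] intro: pick_in_set_le)
qed

lemma supp_subset: "x \<in> carrier_vec n \<Longrightarrow> supp x \<subseteq> {..<n}"
  by (auto simp: supp_def)

lemma card_Collect_less_mem: "I \<subseteq> {..<n} \<Longrightarrow> card {i. i < n \<and> i \<in> I} = card I"
  by (rule arg_cong[of _ _ card]) auto

lemma pick_less:
  assumes "I \<subseteq> {..<n}" "i < card I"
  shows "pick I i < n"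
  using pick_in_set_le[OF assms(2)] assms(1) by auto

lemma cols_submatrix_carrier:
  assumes "A \<in> carrier_mat m n" "I \<subseteq> {..<n}"
  shows "cols_submatrix A I \<in> carrier_mat m (card I)"
  using assms by (intro carrier_matI) (auto simp: dim_submatrix card_Collect_less_mem)

lemma subvector_carrier:
  assumes "x \<in> carrier_vec n" "I \<subseteq> {..<n}"
  shows "subvector x I \<in> carrier_vec (card I)"
  using assms by (simp add: subvector_def card_Collect_less_mem)

lemma subvector_index:
  assumes "x \<in> carrier_vec n" "I \<subseteq> {..<n}" "i < card I"
  shows "subvector x I $ i = x $ pick I i"
  using assms by (simp add: subvector_def card_Collect_less_mem)

lemma cols_submatrix_index:
  assumes "A \<in> carrier_mat m n" "I \<subseteq> {..<n}" "k < m" "i < card I"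
  shows "cols_submatrix A I $$ (k, i) = A $$ (k, pick I i)"
  using assms by (simp add: submatrix_index card_Collect_less_mem pick_UNIV)

text \<open>The columns left out are those multiplied by zero entries of \<open>y\<close>.\<close>

lemma cols_submatrix_mult_subvector:
  assumes A: "A \<in> carrier_mat m n" and y: "y \<in> carrier_vec n"
    and I: "I \<subseteq> {..<n}" and supp: "supp y \<subseteq> I"
  shows "cols_submatrix A I *\<^sub>v subvector y I = A *\<^sub>v y"
proof (rule eq_vecI)
  note B = cols_submatrix_carrier[OF A I] and v = subvector_carrier[OF y I]
  show "dim_vec (cols_submatrix A I *\<^sub>v subvector y I) = dim_vec (A *\<^sub>v y)"
    using A B by simp
  fix k assume "k < dim_vec (A *\<^sub>v y)"
  then have k: "k < m"
    using A by simp
  have "(cols_submatrix A I *\<^sub>v subvector y I) $ k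
          = (\<Sum>i<card I. A $$ (k, pick I i) * y $ pick I i)"
    using B v k
    by (simp add: scalar_prod_def lessThan_atLeast0 cols_submatrix_index[OF A I]
        subvector_index[OF y I])
  also have "\<dots> = (\<Sum>i\<in>I. A $$ (k, i) * y $ i)"
    using bij_betw_pick[of I] I finite_subset[of I "{..<n}"]
    by (intro sum.reindex_bij_betw) auto
  also have "\<dots> = (\<Sum>i<n. A $$ (k, i) * y $ i)"
    using I supp y by (intro sum.mono_neutral_left) (auto simp: supp_def)
  also have "\<dots> = (A *\<^sub>v y) $ k"
    using A y k by (simp add: scalar_prod_def lessThan_atLeast0)
  finally show "(cols_submatrix A I *\<^sub>v subvector y I) $ k = (A *\<^sub>v y) $ k" .
qed

lemma transpose_cols_submatrix_mult_index:
  assumes A: "A \<in> carrier_mat m n" and r: "r \<in> carrier_vec m"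
    and I: "I \<subseteq> {..<n}" and i: "i < card I"
  shows "((cols_submatrix A I)\<^sup>T *\<^sub>v r) $ i = (A\<^sup>T *\<^sub>v r) $ pick I i"
  using A r i cols_submatrix_carrier[OF A I] pick_less[OF I i]
  by (simp add: scalar_prod_def cols_submatrix_index[OF A I])

lemma subvector_surj:
  assumes I: "I \<subseteq> {..<n}" and v: "v \<in> carrier_vec (card I)"
  obtains y where "y \<in> carrier_vec n" "supp y \<subseteq> I" "subvector y I = v"
proof
  \<comment> \<open>Extension by zero: the number of elements of \<open>I\<close> below
    \<open>j\<close> is the 0-based position of \<open>j\<close> in \<open>I\<close>, so it inverts
    \<open>pick I\<close>.\<close>
  let ?y = "vec n (\<lambda>j. if j \<in> I then v $ card {a \<in> I. a < j} else 0)"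
  show y: "?y \<in> carrier_vec n" and "supp ?y \<subseteq> I"
    by (auto simp: supp_def split: if_splits)
  show "subvector ?y I = v"
    using v pick_in_set_le[of _ I] pick_less[OF I] subvector_carrier[OF y I]
    by (intro eq_vecI) (simp_all add: subvector_index[OF y I] card_pick_le)
qed

text \<open>The condition \<open>c > 0\<close> comes from the 0 inserted into the maximum.\<close>

lemma linf_norm_less_iff: "linf_norm v < c \<longleftrightarrow> c > 0 \<and> (\<forall>i<dim_vec v. \<bar>v $ i\<bar> < c)"
  by (auto simp: linf_norm_def)

text \<open>Full rank of a square matrix gives a nonzero determinant, hence an inverse to apply to
  \<open>a\<close>.\<close>

lemma square_full_rank_solvable:
  assumes B: "B \<in> carrier_mat m k" and "square_mat B" "full_rank B" and a: "a \<in> carrier_vec m"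
  obtains c where "c \<in> carrier_vec k" "B *\<^sub>v c = a"
proof -
  have k: "k = m"
    using assms by simp
  have "mat_rank B = m"
    using assms by (simp add: full_rank_def)
  then have "det B \<noteq> 0"
    using B k vec_space.det_rank_iff[of B m] by simp
  then have "B \<in> Units (ring_mat TYPE(real) m ())"
    using B k by (intro det_non_zero_imp_unit) auto
  then obtain C where C: "C \<in> carrier_mat m m" "B * C = 1\<^sub>m m"
    by (auto simp: Units_def ring_mat_def)
  show thesis
  proof
    show "C *\<^sub>v a \<in> carrier_vec k"
      using C a k by simp
    show "B *\<^sub>v (C *\<^sub>v a) = a"
      using B C a k by (simp flip: assoc_mult_mat_vec)
  qed
qed

section \<open>Optimality conditions\<close>

lemma lasso_gradient_on_supp:
  assumes A: "A \<in> carrier_mat m n" and b: "b \<in> carrier_vec m"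
    and min: "is_arg_min (lasso_objective A b l) (\<lambda>y. y \<in> carrier_vec n) x"
    and i: "i \<in> supp x"
  shows "(A\<^sup>T *\<^sub>v (b - A *\<^sub>v x)) $ i = l * sgn (x $ i)"
proof -
  let ?g = "A\<^sup>T *\<^sub>v (b - A *\<^sub>v x)"
  have x: "x \<in> carrier_vec n"
    using min by (simp add: is_arg_min_def)
  have i': "i < n" "x $ i \<noteq> 0"
    using i x by (auto simp: supp_def)
  \<comment> \<open>As \<open>x $ i\<close> is nonzero, the slope along \<open>s\<close> times the
    unit vector is linear in \<open>s\<close>; the signs 1 and -1 then force its coefficient to
    vanish.\<close>
  have "s * (l * sgn (x $ i) - ?g $ i) \<ge> 0" for s
  proof -
    have "0 \<le> lasso_slope A b l x (s \<cdot>\<^sub>v unit_vec n i)"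
      using min by (intro lasso_slope_nonneg[OF A b]) auto
    also have "\<dots> = (\<Sum>j<n. if j = i then s * (l * sgn (x $ i) - ?g $ i) else 0)"
      unfolding lasso_slope_def using i'
      by (intro sum.cong) (auto simp: abs_slope_def algebra_simps)
    also have "\<dots> = s * (l * sgn (x $ i) - ?g $ i)"
      using i' by simp
    finally show ?thesis .
  qed
  from this[of 1] this[of "-1"] show ?thesis
    by simp
qed

lemma lasso_gradient_off_supp:
  assumes A: "A \<in> carrier_mat m n" and b: "b \<in> carrier_vec m"
    and min: "unique_minimizer_on (lasso_objective A b l) (carrier_vec n) x"
    and y: "y \<in> carrier_vec n" and supp: "supp y \<subseteq> supp x" and Ay: "A *\<^sub>v y = col A j"
    and j: "j < n" "j \<notin> supp x"
  shows "\<bar>(A\<^sup>T *\<^sub>v (b - A *\<^sub>v x)) $ j\<bar> < l"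
proof -
  let ?g = "A\<^sup>T *\<^sub>v (b - A *\<^sub>v x)"
  have arg_min: "is_arg_min (lasso_objective A b l) (\<lambda>y. y \<in> carrier_vec n) x"
    using min by (simp add: unique_minimizer_on_def)
  have x: "x \<in> carrier_vec n"
    using arg_min by (simp add: is_arg_min_def)
  have zero: "x $ j = 0" "y $ j = 0"
    using j x y supp by (auto simp: supp_def)
  have off: "y $ i = 0" if "i < n" "x $ i = 0" for i
    using that y x supp by (auto simp: supp_def)
  have "s * ?g $ j < l" if s: "\<bar>s\<bar> = 1" for s
  proof -
    define d where "d = s \<cdot>\<^sub>v (unit_vec n j - y)"
    have d: "d \<in> carrier_vec n"
      using y by (simp add: d_def)
    have d_index: "d $ i = s * ((if i = j then 1 else 0) - y $ i)" if "i < n" for i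
      using that y j by (simp add: d_def)
    \<comment> \<open>The entry of \<open>d\<close> at \<open>j\<close> is \<open>s\<close>, because
      \<open>y\<close> vanishes there.\<close>
    have "d \<noteq> 0\<^sub>v n"
      using d_index[OF j(1)] zero j s by auto
    moreover have "A *\<^sub>v d = 0\<^sub>v m"
    proof -
      have "A *\<^sub>v unit_vec n j = col A j"
      proof (rule eq_vecI)
        fix i assume "i < dim_vec (col A j)"
        then show "(A *\<^sub>v unit_vec n j) $ i = col A j $ i"
          using A j by auto
      qed (use A in auto)
      then have "A *\<^sub>v (unit_vec n j - y) = 0\<^sub>v m"
        using A y mult_minus_distrib_mat_vec[OF A unit_vec_carrier y] by (auto simp: Ay)
      then show ?thesis
        using A y by (auto simp: d_def mult_mat_vec[OF A])
    qed
    ultimately have "0 < lasso_slope A b l x d"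
      using lasso_slope_pos[OF A b d min] by simp
    also have "\<dots> = (\<Sum>i<n. if i = j then l - s * ?g $ j else 0)"
      unfolding lasso_slope_def
    proof (intro sum.cong)
      fix i assume "i \<in> {..<n}"
      then have i: "i < n"
        by simp
      show "l * abs_slope (x $ i) (d $ i) - d $ i * ?g $ i = (if i = j then l - s * ?g $ j else 0)"
      \<comment> \<open>Off the support, \<open>y\<close> vanishes, so only \<open>i = j\<close>
        contributes, with \<open>\<bar>s\<bar> = 1\<close> as slope of the absolute value. On the
        support, the gradient identity cancels the term whatever \<open>d $ i\<close> is.\<close>
      proof (cases "x $ i = 0")
        case True
        then show ?thesis
          using i s zero off[OF i] by (auto simp: abs_slope_def d_index)
      next
        case False
        then have "?g $ i = l * sgn (x $ i)"
          using i x by (intro lasso_gradient_on_supp[OF A b arg_min]) (auto simp: supp_def)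
        then show ?thesis
          using False zero by (auto simp: abs_slope_def)
      qed
    qed (use d in auto)
    also have "\<dots> = l - s * ?g $ j"
      using j by simp
    finally show ?thesis
      by simp
  qed
  from this[of 1] this[of "-1"] show ?thesis
    by simp
qed

theorem corollary1:
  fixes A :: "real mat" and b x :: "real vec" and l :: real and m n :: nat and I :: "nat set"
  assumes "A \<in> carrier_mat m n"
    and "b \<in> carrier_vec m"
    and "l > 0"
    and "unique_minimizer_on (lasso_objective A b l) (carrier_vec n) x"
    and "I = supp x"
    and "square_mat (cols_submatrix A I)"
    and "full_rank (cols_submatrix A I)"
  shows "(cols_submatrix A I)\<^sup>T *\<^sub>v (b - cols_submatrix A I *\<^sub>v subvector x I)
           = l \<cdot>\<^sub>v map_vec sgn (subvector x I)
       \<and> linf_norm ((cols_submatrix A ({..<n} - I))\<^sup>T *\<^sub>v (b - cols_submatrix A I *\<^sub>v subvector x I)) < l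
       \<and> full_column_rank (cols_submatrix A I)"
proof (intro conjI)
  note A = assms(1) and b = assms(2)
  have min: "is_arg_min (lasso_objective A b l) (\<lambda>y. y \<in> carrier_vec n) x"
    using assms(4) by (simp add: unique_minimizer_on_def)
  have x: "x \<in> carrier_vec n"
    using min by (simp add: is_arg_min_def)
  have I: "I \<subseteq> {..<n}"
    using supp_subset[OF x] assms(5) by simp
  \<comment> \<open>Hence the residual in all the claims is that of the full system.\<close>
  have Ax: "cols_submatrix A I *\<^sub>v subvector x I = A *\<^sub>v x"
    using cols_submatrix_mult_subvector[OF A x I] assms(5) by simp
  have r: "b - A *\<^sub>v x \<in> carrier_vec m"
    using b mult_mat_vec_carrier[OF A x] by (rule minus_carrier_vec)
  note B = cols_submatrix_carrier[OF A I] and v = subvector_carrier[OF x I]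
  show "(cols_submatrix A I)\<^sup>T *\<^sub>v (b - cols_submatrix A I *\<^sub>v subvector x I)
      = l \<cdot>\<^sub>v map_vec sgn (subvector x I)"
  proof (rule eq_vecI)
    fix i assume "i < dim_vec (l \<cdot>\<^sub>v map_vec sgn (subvector x I))"
    then have i: "i < card I"
      using v by simp
    have "((cols_submatrix A I)\<^sup>T *\<^sub>v (b - A *\<^sub>v x)) $ i = l * sgn (x $ pick I i)"
      using lasso_gradient_on_supp[OF A b min] pick_in_set_le[OF i] assms(5)
        transpose_cols_submatrix_mult_index[OF A r I i] by simp
    then show "((cols_submatrix A I)\<^sup>T *\<^sub>v (b - cols_submatrix A I *\<^sub>v subvector x I)) $ i
        = (l \<cdot>\<^sub>v map_vec sgn (subvector x I)) $ i"
      using i v by (simp add: Ax subvector_index[OF x I])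
  qed (use B v in simp)
  show "linf_norm ((cols_submatrix A ({..<n} - I))\<^sup>T
      *\<^sub>v (b - cols_submatrix A I *\<^sub>v subvector x I)) < l"
    unfolding linf_norm_less_iff Ax
  proof (intro conjI allI impI)
    let ?J = "{..<n} - I"
    fix i assume "i < dim_vec ((cols_submatrix A ?J)\<^sup>T *\<^sub>v (b - A *\<^sub>v x))"
    then have i: "i < card ?J"
      using cols_submatrix_carrier[OF A, of ?J] by auto
    have j: "pick ?J i < n" "pick ?J i \<notin> I"
      using pick_in_set_le[OF i] by auto
    \<comment> \<open>Invertibility of the support columns expresses the outside column through
      them; padding \<open>c\<close> with zeros then gives the vector \<open>y\<close> of the kernel
      direction.\<close>
    obtain c where c: "c \<in> carrier_vec (card I)" "cols_submatrix A I *\<^sub>v c = col A (pick ?J i)"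
      using square_full_rank_solvable[OF B assms(6,7)] A by (metis carrier_matD(1) col_dim)
    obtain y where y: "y \<in> carrier_vec n" "supp y \<subseteq> I" "subvector y I = c"
      using subvector_surj[OF I c(1)] .
    have "A *\<^sub>v y = col A (pick ?J i)"
      using cols_submatrix_mult_subvector[OF A y(1) I y(2)] c y by simp
    then have "\<bar>(A\<^sup>T *\<^sub>v (b - A *\<^sub>v x)) $ pick ?J i\<bar> < l"
      using lasso_gradient_off_supp[OF A b assms(4) y(1)] y(2) j assms(5) by simp
    then show "\<bar>((cols_submatrix A ?J)\<^sup>T *\<^sub>v (b - A *\<^sub>v x)) $ i\<bar> < l"
      using transpose_cols_submatrix_mult_index[OF A r _ i] by simp
  \<comment> \<open>The remaining goal is \<open>l > 0\<close>, which alone settles the bound when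
    the complement of \<open>I\<close> is empty.\<close>
  qed (rule assms(3))
  \<comment> \<open>For a square matrix the minimum of the two dimensions is the number of
    columns.\<close>
  show "full_column_rank (cols_submatrix A I)"
    using assms(6,7) by (simp add: full_rank_def full_column_rank_def)
qed

end
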